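(* Let $d,k,n$ be integers with $d\geq 1$ and $2\leq k\leq n$, and let $P_n$ be the path with vertex set $\{1,\ldots,n\}$ and edges $\{i,i+1\}$ for $1\le i\le n-1$. Then \[\mathrm{gp}^k_d(P_n)=\begin{cases} n & \text{if } 1\leq d\leq k-2,\\ (k-1)\left\lfloor\frac{n}{d+1}\right\rfloor+\min\bigl(n \bmod (d+1),\,k-1\bigr) & \text{if } k-1\leq d.\end{cases}\]
   Context: For a graph $G$, a geodesic of $G$ is a shortest path between two vertices of $G$; its length $\lambda(g)$ is its number of edges and $V(g)$ is its vertex set. For integers $d\ge1$, $k\ge2$, a set $S\subseteq V(G)$ is a $k$-general $d$-position set in $G$ if for every geodesic $g$ of $G$, $|S\cap V(g)|\geq k$ implies $\lambda(g)>d$. The $k$-general $d$-position number $\mathrm{gp}^k_d(G)$ is the largest cardinality of a $k$-general $d$-position set in $G$. *)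

theory Defs
  imports "Graph_Theory.Pair_Digraph"
begin

(* Graphs are the finite simple graphs of the library (locale graph): every undirected edge
   is a pair of opposite arcs.  A path is an apath from u to v, given by its list of arcs; its
   number of edges is the length of that list, and a single vertex is a path of length 0. *)

context pre_digraph
begin

definition geodesic :: "'a \<Rightarrow> 'b awalk \<Rightarrow> 'a \<Rightarrow> bool" where
  "geodesic u p v \<longleftrightarrow> apath u p v \<and> (\<forall>q. apath u q v \<longrightarrow> length p \<le> length q)"

definition general_position_set :: "nat \<Rightarrow> nat \<Rightarrow> 'a set \<Rightarrow> bool" where
  "general_position_set k d S \<longleftrightarrow>
     S \<subseteq> verts G \<and>
     (\<forall>u p v. geodesic u p v \<longrightarrow> k \<le> card (S \<inter> set (awalk_verts u p)) \<longrightarrow> d < length p)"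

definition gp_number :: "nat \<Rightarrow> nat \<Rightarrow> nat" where
  "gp_number k d = Max {card S | S. general_position_set k d S}"

end

(* The maximum in gp_number ranges over a finite nonempty set. *)

lemma (in fin_digraph) finite_general_position_cards:
  "finite {card S | S. general_position_set k d S}"
proof -
  have "{card S | S. general_position_set k d S} \<subseteq> card ` Pow (verts G)"
    by (auto simp: general_position_set_def)
  then show ?thesis
    by (rule finite_subset) simp
qed

lemma (in pre_digraph) general_position_set_empty:
  "1 \<le> k \<Longrightarrow> general_position_set k d {}"
  by (simp add: general_position_set_def)

definition path_graph :: "nat \<Rightarrow> nat pair_pre_digraph" where
  "path_graph n =
     \<lparr> pverts = {1..n}, parcs = (\<Union>i\<in>{1..<n}. {(i, i + 1), (i + 1, i)}) \<rparr>"

lemma pair_graph_path_graph: "pair_graph (path_graph n)"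
  by unfold_locales (auto simp: path_graph_def symmetric_def intro!: symI)

lemma graph_path_graph: "graph (with_proj (path_graph n))"
proof -
  interpret pair_graph "path_graph n" by (rule pair_graph_path_graph)
  show ?thesis by unfold_locales
qed

end

theory Submission
  imports Defs
begin

text \<open>
  A walk of length l in \<open>P\<^sub>n\<close> stays inside l + 1 consecutive vertices, and every interval of
  vertices carries a geodesic; so S is in general position iff each d + 1 consecutive integers
  contain fewer than k elements of S. Cutting \<open>{1..n}\<close> into blocks of length d + 1 gives the
  upper bound, and the first k - 1 vertices of every block attain it.
\<close>

lemma pverts_path_graph [simp]: "pverts (path_graph n) = {1..n}"
  by (simp add: path_graph_def)

lemma parcs_path_graph:
  "(u, v) \<in> parcs (path_graph n) \<longleftrightarrow>
     u \<in> {1..n} \<and> v \<in> {1..n} \<and> (v = Suc u \<or> u = Suc v)"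
  by (auto simp: path_graph_def)

lemma wf_digraph_path_graph: "wf_digraph (with_proj (path_graph n))"
proof -
  interpret graph "with_proj (path_graph n)" by (rule graph_path_graph)
  show ?thesis by unfold_locales
qed

text \<open>Every arc changes the vertex by exactly one, so prepending an arc extends the interval
  by at most one, at one of its ends. The walk may turn back, hence the left end \<open>a\<close> is
  only asserted to exist.\<close>

lemma awalk_path_graph_window:
  assumes "pre_digraph.awalk (with_proj (path_graph n)) u p v"
  shows "\<exists>a. set (pre_digraph.awalk_verts (with_proj (path_graph n)) u p) \<subseteq> {a..a + length p}"
proof -
  interpret wf_digraph "with_proj (path_graph n)" by (rule wf_digraph_path_graph)
  from assms have "\<exists>a. set (awalk_verts u p) \<subseteq> {a..a + length p} \<and> u \<in> {a..a + length p}"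
  proof (induction p arbitrary: u)
    case Nil
    then show ?case by auto
  next
    case (Cons e p)
    then obtain u' where e: "e = (u, u')" and walk: "awalk u' p v"
      and arc: "e \<in> arcs (with_proj (path_graph n))"
      by (cases e) (auto simp: awalk_Cons_iff)
    obtain a where a: "set (awalk_verts u' p) \<subseteq> {a..a + length p}" "u' \<in> {a..a + length p}"
      using Cons.IH[OF walk] by auto
    have "u = u' + 1 \<or> u' = u + 1"
      using arc by (auto simp: e parcs_path_graph)
    \<comment> \<open>The left end moves only if \<open>u\<close> is \<open>a - 1\<close>; otherwise
      it stays at \<open>a\<close>, and the extra unit of length leaves room for \<open>u\<close> on
      the right.\<close>
    with a(2) have "insert u {a..a + length p} \<subseteq> {min a u..min a u + length (e # p)}"
      by auto
    with a(1) have "insert u (set (awalk_verts u' p)) \<subseteq> {min a u..min a u + length (e # p)}"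
      by blast
    then show ?case by (intro exI[of _ "min a u"]) (simp add: e)
  qed
  then show ?thesis by blast
qed

text \<open>An arc raises the vertex by at most one. This is the lower bound that makes increasing
  paths shortest.\<close>

lemma awalk_path_graph_length:
  assumes "pre_digraph.awalk (with_proj (path_graph n)) u p v"
  shows "v \<le> u + length p"
proof -
  interpret wf_digraph "with_proj (path_graph n)" by (rule wf_digraph_path_graph)
  from assms show ?thesis
  proof (induction p arbitrary: u)
    case (Cons e p)
    then obtain u' where "awalk u' p v" and "u' \<le> Suc u"
      by (cases e) (auto simp: awalk_Cons_iff parcs_path_graph)
    with Cons.IH[of u'] show ?case by simp
  qed (simp add: awalk_Nil_iff)
qed

lemma awalk_verts_path_graph_upt:
  assumes "a \<le> b"
  shows "pre_digraph.awalk_verts (with_proj (path_graph n)) a (map (\<lambda>i. (i, Suc i)) [a..<b])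
    = [a..<b + 1]"
  using assms
proof (induction "b - a" arbitrary: a)
  case 0
  then show ?case by (simp add: pre_digraph.awalk_verts.simps)
next
  case (Suc x)
  then have "a < b" by simp
  then show ?case
    using Suc by (simp add: pre_digraph.awalk_verts.simps upt_conv_Cons del: upt_Suc)
qed

lemma awalk_path_graph_upt:
  assumes "1 \<le> a" "a \<le> b" "b \<le> n"
  shows "pre_digraph.awalk (with_proj (path_graph n)) a (map (\<lambda>i. (i, Suc i)) [a..<b]) b"
proof -
  interpret wf_digraph "with_proj (path_graph n)" by (rule wf_digraph_path_graph)
  from assms show ?thesis
  proof (induction "b - a" arbitrary: a)
    case 0
    then show ?case by (simp add: awalk_Nil_iff)
  next
    case (Suc x)
    then have "a < b" by simp
    then show ?case
      using Suc by (simp add: awalk_Cons_iff parcs_path_graph upt_conv_Cons del: upt_Suc)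
  qed
qed

lemma geodesic_path_graph_upt:
  assumes "1 \<le> a" "a \<le> b" "b \<le> n"
  shows "pre_digraph.geodesic (with_proj (path_graph n)) a (map (\<lambda>i. (i, Suc i)) [a..<b]) b"
proof -
  interpret wf_digraph "with_proj (path_graph n)" by (rule wf_digraph_path_graph)
  let ?p = "map (\<lambda>i. (i, Suc i)) [a..<b]"
  have "apath a ?p b"
    unfolding apath_def awalk_verts_path_graph_upt[OF assms(2)]
    using awalk_path_graph_upt[OF assms] by simp
  moreover have "length ?p \<le> length q" if "apath a q b" for q
    using awalk_path_graph_length[of n a q b] that by (simp add: apath_def)
  ultimately show ?thesis by (simp add: geodesic_def)
qed

text \<open>Removes the graph theory: from here on only counting in windows of \<open>d + 1\<close>
  consecutive naturals remains. Windows may stick out of \<open>{1..n}\<close>, which spares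
  boundary cases later.\<close>

lemma general_position_set_path_graph_iff:
  assumes "1 \<le> k"
  shows "pre_digraph.general_position_set (with_proj (path_graph n)) k d S \<longleftrightarrow>
    S \<subseteq> {1..n} \<and> (\<forall>a. card (S \<inter> {a..a + d}) < k)"
proof -
  interpret wf_digraph "with_proj (path_graph n)" by (rule wf_digraph_path_graph)
  show ?thesis
  proof (intro iffI conjI allI)
    fix a
    assume S: "general_position_set k d S"
    then have sub: "S \<subseteq> {1..n}"
      by (simp add: general_position_set_def)
    \<comment> \<open>Clipping the window to \<open>{1..n}\<close> loses no element of
      \<open>S\<close> and leaves an interval that is the vertex set of a geodesic with at most
      \<open>d\<close> arcs.\<close>
    define l r where "l = max 1 a" and "r = min (a + d) n"
    have eq: "S \<inter> {a..a + d} = S \<inter> {l..r}"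
      using sub by (auto simp: l_def r_def)
    show "card (S \<inter> {a..a + d}) < k"
    proof (cases "l \<le> r")
      case True
      let ?p = "map (\<lambda>i. (i, Suc i)) [l..<r]"
      have "geodesic l ?p r"
        using True by (intro geodesic_path_graph_upt) (auto simp: l_def r_def)
      moreover have "set (awalk_verts l ?p) = {l..r}"
        using True by (simp add: awalk_verts_path_graph_upt atLeastLessThanSuc_atLeastAtMost
            del: upt_Suc)
      moreover have "length ?p \<le> d"
        by (simp add: l_def r_def)
      ultimately show ?thesis
        using S eq unfolding general_position_set_def by (metis not_le)
    next
      \<comment> \<open>The window misses \<open>{1..n}\<close>, so the intersection is empty and
        \<open>1 \<le> k\<close> suffices.\<close>
      case False
      then show ?thesis using eq assms by simp
    qed
  next
    assume S: "S \<subseteq> {1..n} \<and> (\<forall>a. card (S \<inter> {a..a + d}) < k)"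
    have "d < length p"
      if geo: "geodesic u p v" and k: "k \<le> card (S \<inter> set (awalk_verts u p))" for u p v
    proof (rule ccontr)
      assume short: "\<not> d < length p"
      obtain a where "set (awalk_verts u p) \<subseteq> {a..a + length p}"
        using geo awalk_path_graph_window[of n u p v] by (auto simp: geodesic_def apath_def)
      with short have "S \<inter> set (awalk_verts u p) \<subseteq> S \<inter> {a..a + d}"
        by fastforce
      then have "card (S \<inter> set (awalk_verts u p)) \<le> card (S \<inter> {a..a + d})"
        by (intro card_mono) auto
      with k S show False by (meson leD le_less_trans)
    qed
    with S show "general_position_set k d S"
      by (auto simp: general_position_set_def)
  qed (auto simp: general_position_set_def)
qed

text \<open>Splits the computation of the maximum into an upper bound for all admissible sets and
  one witness of size \<open>N\<close>.\<close>

lemma gp_number_path_graph_eqI: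
  assumes "1 \<le> k"
    and "\<And>S. S \<subseteq> {1..n} \<Longrightarrow> (\<And>a. card (S \<inter> {a..a + d}) < k) \<Longrightarrow> card S \<le> N"
    and "S \<subseteq> {1..n}" "\<And>a. card (S \<inter> {a..a + d}) < k" "card S = N"
  shows "pre_digraph.gp_number (with_proj (path_graph n)) k d = N"
proof -
  interpret graph "with_proj (path_graph n)" by (rule graph_path_graph)
  show ?thesis
    unfolding gp_number_def
  proof (rule Max_eqI)
    show "finite {card S |S. general_position_set k d S}"
      by (rule finite_general_position_cards)
    show "y \<le> N" if "y \<in> {card S |S. general_position_set k d S}" for y
      using that assms(2) by (auto simp: general_position_set_path_graph_iff[OF assms(1)])
    show "N \<in> {card S |S. general_position_set k d S}"
      using assms(3-5) by (auto simp: general_position_set_path_graph_iff[OF assms(1)])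
  qed
qed

lemma card_Int_blocks_le:
  fixes S :: "nat set"
  assumes "\<And>a. card (S \<inter> {a..<a + m}) \<le> c"
  shows "card (S \<inter> {b..<b + m * q}) \<le> c * q"
proof (induction q)
  case (Suc q)
  have "S \<inter> {b..<b + m * Suc q} =
      S \<inter> {b..<b + m * q} \<union> S \<inter> {b + m * q..<b + m * q + m}"
    by auto
  then have "card (S \<inter> {b..<b + m * Suc q}) \<le>
      card (S \<inter> {b..<b + m * q}) + card (S \<inter> {b + m * q..<b + m * q + m})"
    by (metis card_Un_le)
  also have "\<dots> \<le> c * q + c"
    by (intro add_mono Suc assms)
  finally show ?case by simp
qed simp

text \<open>Each of the \<open>n div m\<close> full blocks contributes at most \<open>c\<close>. The
  remainder is bounded both by its own length and, being part of one more window, by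
  \<open>c\<close>.\<close>

lemma card_le_of_window_bound:
  fixes S :: "nat set"
  assumes "0 < m" and "S \<subseteq> {b..<b + n}" and "\<And>a. card (S \<inter> {a..<a + m}) \<le> c"
  shows "card S \<le> c * (n div m) + min (n mod m) c"
proof -
  \<comment> \<open>The start of the incomplete last block.\<close>
  define e where "e = b + m * (n div m)"
  have n: "b + n = e + n mod m"
    by (simp add: e_def)
  have "S = S \<inter> {b..<e} \<union> S \<inter> {e..<e + n mod m}"
    using assms(2) n by auto
  then have "card S \<le> card (S \<inter> {b..<e}) + card (S \<inter> {e..<e + n mod m})"
    by (metis card_Un_le)
  moreover have "card (S \<inter> {b..<e}) \<le> c * (n div m)"
    unfolding e_def by (rule card_Int_blocks_le[OF assms(3)])
  moreover have "card (S \<inter> {e..<e + n mod m}) \<le> card {e..<e + n mod m}"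
    by (rule card_mono) auto
  moreover have "card (S \<inter> {e..<e + n mod m}) \<le> card (S \<inter> {e..<e + m})"
    using mod_less_divisor[OF assms(1), of n] by (intro card_mono) auto
  ultimately show ?thesis
    using assms(3)[of e] by simp
qed

lemma inj_on_mod_window: "inj_on (\<lambda>x. x mod m) {a..<a + m :: nat}"
proof (rule linorder_inj_onI)
  fix x y
  assume "x < y" and "x \<in> {a..<a + m}" "y \<in> {a..<a + m}"
  then have "0 < y - x" "y - x < m" by auto
  then have "\<not> m dvd y - x" by (simp add: nat_dvd_not_less)
  then show "x mod m \<noteq> y mod m"
    using \<open>x < y\<close> by (metis less_imp_le mod_eq_dvd_iff_nat)
qed auto

text \<open>Residues are distinct within a window, and only \<open>c\<close> of them are below
  \<open>c\<close>. The window need not be aligned with the blocks.\<close>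

lemma card_residues_window_le: "card {x \<in> {a..<a + m}. x mod m < (c::nat)} \<le> c"
proof -
  have "card {x \<in> {a..<a + m}. x mod m < c} \<le> card {..<c}"
    by (rule card_inj_on_le[where f = "\<lambda>x. x mod m"])
      (auto intro: inj_on_subset[OF inj_on_mod_window])
  then show ?thesis by simp
qed

text \<open>Induction on \<open>n\<close>: the count grows exactly when \<open>n mod m < c\<close>.
  When a block closes, \<open>c \<le> m\<close> guarantees that it has contributed exactly
  \<open>c\<close>, so the minimum resets to 0 as the quotient grows.\<close>

lemma card_residues_less:
  assumes "c \<le> m"
  shows "card {x. x < n \<and> x mod m < c} = c * (n div m) + min (n mod m) (c::nat)"
proof (induction n)
  case (Suc n)
  have "{x. x < Suc n \<and> x mod m < c} =
      (if n mod m < c then insert n {x. x < n \<and> x mod m < c} else {x. x < n \<and> x mod m < c})"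
    by (auto simp: less_Suc_eq)
  then show ?case
    using Suc assms by (auto simp: div_Suc mod_Suc min_def)
qed simp

theorem theorem3p3:
  fixes d k n :: nat
  assumes "1 \<le> d" and "2 \<le> k" and "k \<le> n"
  shows "(1 \<le> d \<and> d \<le> k - 2 \<longrightarrow>
            pre_digraph.gp_number (with_proj (path_graph n)) k d = n) \<and>
         (k - 1 \<le> d \<longrightarrow>
            pre_digraph.gp_number (with_proj (path_graph n)) k d =
              (k - 1) * (n div (d + 1)) + min (n mod (d + 1)) (k - 1))"
proof (intro conjI impI)
  assume d: "1 \<le> d \<and> d \<le> k - 2"
  show "pre_digraph.gp_number (with_proj (path_graph n)) k d = n"
  \<comment> \<open>A window has \<open>d + 1 < k\<close> elements, so all vertices may be
    taken.\<close>
  proof (rule gp_number_path_graph_eqI[where S = "{1..n}"])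
    show "card S \<le> n" if "S \<subseteq> {1..n}" for S
      using card_mono[OF _ that] by simp
    show "card ({1..n} \<inter> {a..a + d}) < k" for a
    proof -
      have "card ({1..n} \<inter> {a..a + d}) \<le> card {a..a + d}"
        by (rule card_mono) auto
      also have "\<dots> < k"
        using d assms(2) by auto
      finally show ?thesis .
    qed
  qed (use assms in auto)
next
  assume d: "k - 1 \<le> d"
  let ?m = "d + 1" and ?c = "k - 1"
  have window: "{a..a + d} = {a..<a + ?m}" for a
    by auto
  have less_k: "x < k \<longleftrightarrow> x \<le> ?c" for x
    using assms(2) by auto
  \<comment> \<open>Blocks are counted from 0 to match residues; \<open>Suc\<close> shifts the set
    to the vertices \<open>{1..n}\<close>.\<close>
  let ?R = "{x. x < n \<and> x mod ?m < ?c}"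
  show "pre_digraph.gp_number (with_proj (path_graph n)) k d =
      ?c * (n div ?m) + min (n mod ?m) ?c"
  proof (rule gp_number_path_graph_eqI[where S = "Suc ` ?R"])
    show "card S \<le> ?c * (n div ?m) + min (n mod ?m) ?c"
      if "S \<subseteq> {1..n}" "\<And>a. card (S \<inter> {a..a + d}) < k" for S
      using that unfolding window less_k
      by (intro card_le_of_window_bound[where b = 1]) auto
    show "card (Suc ` ?R \<inter> {a..a + d}) < k" for a
    proof -
      \<comment> \<open>Undoing the shift moves the window to \<open>a - 1\<close>. For
        \<open>a = 0\<close> the subtraction truncates, and the window at 0 still contains all
        preimages.\<close>
      have "Suc ` ?R \<inter> {a..a + d} \<subseteq> Suc ` {x \<in> {a - 1..<a - 1 + ?m}. x mod ?m < ?c}"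
        by (auto intro!: imageI)
      then have "card (Suc ` ?R \<inter> {a..a + d}) \<le>
          card (Suc ` {x \<in> {a - 1..<a - 1 + ?m}. x mod ?m < ?c})"
        by (intro card_mono) auto
      also have "\<dots> \<le> ?c"
        by (simp only: card_image[OF inj_Suc] card_residues_window_le)
      finally show ?thesis by (simp only: less_k)
    qed
    \<comment> \<open>Here \<open>k - 1 \<le> d\<close> is used: it ensures that a block has room
      for \<open>k - 1\<close> chosen vertices.\<close>
    show "card (Suc ` ?R) = ?c * (n div ?m) + min (n mod ?m) ?c"
      using d by (simp only: card_image[OF inj_Suc] card_residues_less)
  qed (use assms in auto)
qed

end
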